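(* Let $N\ge 2$ and $s\ge 1$ be integers and let $W=\ldots \alpha_{s-1} \alpha_0 \alpha_1 \ldots \alpha_{s-1} \alpha_0 \alpha_1 \ldots$ be an infinite $s$-periodic word with letters in $\mathbb{Z} / N \mathbb{Z}$. Then there exists a smallest positive integer $t$ such that all subwords of length $ts-1$ in $W$ belong to $\bar{\mathcal{A}}$. Moreover, for this $t$, all subwords of length $lts-1$ of $W$ belong to $\bar{\mathcal{A}}$ for every integer $l \geq 1$.
   Context: $F_N$ is the free monoid of all finite words with letters in $\mathbb{Z}/N\mathbb{Z}$ (identity: the empty word $\varepsilon$); juxtaposition of letters is concatenation. $\pi : F_N \to \mathrm{SL}_2(\mathbb{Z}/N\mathbb{Z})$ is the monoid homomorphism with $\pi(\alpha) = \begin{bmatrix} 0 & 1 \\ -1 & \alpha \end{bmatrix}$ for each letter $\alpha$, so $\pi(\alpha_1\cdots\alpha_l)=\pi(\alpha_1)\cdots\pi(\alpha_l)$ and $\pi(\varepsilon)$ is the identity matrix. On $(\mathbb{Z}/N\mathbb{Z})^2\smallsetminus\{0\}$ (column vectors) let $u\sim' v$ if and only if $u=\lambda v$ for some $\lambda\in(\mathbb{Z}/N\mathbb{Z})^\times$; $\mathrm{SL}_2(\mathbb{Z}/N\mathbb{Z})$ acts on the set of $\sim'$-classes by left multiplication. $\bar{\mathcal{A}} = \left\{w \in F_N : \pi(w)\begin{bmatrix} 0 \\ 1 \end{bmatrix} = \begin{bmatrix} 1 \\ 0 \end{bmatrix} \text{ as } \sim'\text{-classes}\right\}$. An infinite word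 is a bi-infinite sequence of letters indexed by $\mathbb{Z}$; it is $s$-periodic when it is the bi-infinite repetition of a block $\alpha_0\alpha_1\cdots\alpha_{s-1}$ (i.e. letters at positions $i$ and $i+s$ agree for all $i\in\mathbb{Z}$). A subword of length $m$ of $W$ is a word formed by $m$ consecutive letters of $W$ (the empty word if $m=0$). *)

theory Defs
  imports "HOL-Analysis.Analysis" "Berlekamp_Zassenhaus.Finite_Field"
begin

text \<open>
  The ring of integers modulo N is rendered as \<open>'n mod_ring\<close> with N = \<open>CARD('n)\<close>. The class
  \<open>nontriv\<close> says exactly that N is at least 2, and a free type variable of this class stands for
  an arbitrary such N. The free monoid of finite words is \<open>'n mod_ring list\<close>.
\<close>

definition letter_mat :: "'n::nontriv mod_ring \<Rightarrow> 'n mod_ring ^ 2 ^ 2" where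
  "letter_mat a = vector [vector [0, 1], vector [-1, a]]"

text \<open>Matrix multiplication is \<open>**\<close>; the operation \<open>*\<close> on vectors is componentwise.\<close>

primrec word_mat :: "'n::nontriv mod_ring list \<Rightarrow> 'n mod_ring ^ 2 ^ 2" where
  "word_mat [] = mat 1"
| "word_mat (a # w) = letter_mat a ** word_mat w"

lemma word_mat_append: "word_mat (v @ w) = word_mat v ** word_mat w"
  by (induction v) (simp_all add: matrix_mul_assoc)

lemma word_mat_singleton: "word_mat [a] = letter_mat a"
  by simp

lemma det_word_mat: "det (word_mat w) = 1"
proof (induction w)
  case Nil
  show ?case by simp
next
  case (Cons a w)
  have "det (letter_mat a) = 1"
    by (simp add: letter_mat_def det_2)
  with Cons show ?case by (simp add: det_mul)
qed

definition punctured :: "('n::nontriv mod_ring ^ 2) set" where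
  "punctured = UNIV - {0}"

text \<open>Here \<open>l dvd 1\<close> says that the scalar is a unit.\<close>

definition proj_rel :: "(('n::nontriv mod_ring ^ 2) \<times> ('n mod_ring ^ 2)) set" where
  "proj_rel = {(u, v). u \<in> punctured \<and> v \<in> punctured \<and> (\<exists>l. l dvd 1 \<and> u = l *s v)}"

lemma equiv_proj_rel: "equiv punctured (proj_rel :: (('n::nontriv mod_ring ^ 2) \<times> _) set)"
proof (rule equivI)
  show "proj_rel \<subseteq> (punctured :: ('n mod_ring ^ 2) set) \<times> punctured"
    by (auto simp: proj_rel_def)
  show "refl_on (punctured :: ('n mod_ring ^ 2) set) proj_rel"
    by (auto simp: refl_on_def proj_rel_def intro: exI[of _ 1])
  show "sym (proj_rel :: (('n mod_ring ^ 2) \<times> _) set)"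
  proof (rule symI)
    fix u v :: "'n mod_ring ^ 2"
    assume uv: "(u, v) \<in> proj_rel"
    then obtain l where l: "l dvd 1" "u = l *s v" by (auto simp: proj_rel_def)
    from l(1) obtain k where k: "1 = l * k" by (rule dvdE)
    have "k dvd 1" using k by (metis dvd_triv_right)
    moreover have "v = k *s u"
      using l(2) k by (metis mult.commute vector_smult_assoc vector_smult_lid)
    ultimately show "(v, u) \<in> proj_rel" using uv by (auto simp: proj_rel_def)
  qed
  show "trans (proj_rel :: (('n mod_ring ^ 2) \<times> _) set)"
  proof (rule transI)
    fix u v w :: "'n mod_ring ^ 2"
    assume uv: "(u, v) \<in> proj_rel" and vw: "(v, w) \<in> proj_rel"
    then obtain l k where "l dvd 1" "u = l *s v" "k dvd 1" "v = k *s w"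
      by (auto simp: proj_rel_def)
    then have "l * k dvd 1" "u = (l * k) *s w"
      by (metis mult_dvd_mono mult.right_neutral, simp add: vector_smult_assoc)
    then show "(u, w) \<in> proj_rel" using uv vw by (auto simp: proj_rel_def)
  qed
qed

definition proj_class :: "'n::nontriv mod_ring ^ 2 \<Rightarrow> ('n mod_ring ^ 2) set" where
  "proj_class v = proj_rel `` {v}"

definition proj_act ::
  "'n::nontriv mod_ring ^ 2 ^ 2 \<Rightarrow> ('n mod_ring ^ 2) set \<Rightarrow> ('n mod_ring ^ 2) set" where
  "proj_act A C = (\<lambda>v. A *v v) ` C"

lemma proj_act_class:
  fixes A :: "'n::nontriv mod_ring ^ 2 ^ 2"
  assumes "det A = 1"
  shows "proj_act A (proj_class v) = proj_class (A *v v)"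
proof -
  define B :: "'n mod_ring ^ 2 ^ 2"
    where "B = vector [vector [A $ 2 $ 2, - A $ 1 $ 2], vector [- A $ 2 $ 1, A $ 1 $ 1]]"
  have d: "A $ 1 $ 1 * A $ 2 $ 2 - A $ 1 $ 2 * A $ 2 $ 1 = 1"
    using assms by (simp add: det_2)
  have AB: "A ** B = mat 1" and BA: "B ** A = mat 1"
    using d by (simp_all add: B_def matrix_matrix_mult_def mat_def vec_eq_iff forall_2 sum_2
        algebra_simps)
  have ABv: "A *v (B *v x) = x" and BAv: "B *v (A *v x) = x" for x
    by (simp_all add: matrix_vector_mul_assoc AB BA)
  have nz: "A *v x = 0 \<longleftrightarrow> x = 0" for x
    by (metis BAv matrix_vector_mult_0_right)
  have sc: "A *v (l *s x) = l *s (A *v x)" for l x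
    by (simp add: matrix_vector_mult_def vec_eq_iff sum_distrib_left algebra_simps)
  have iff: "(A *v x, A *v y) \<in> proj_rel \<longleftrightarrow> (x, y) \<in> proj_rel" for x y
    unfolding proj_rel_def punctured_def
    by (auto simp: nz sc[symmetric]) (metis BAv)
  show ?thesis
    unfolding proj_act_def proj_class_def
  proof (intro equalityI subsetI)
    fix y assume "y \<in> (\<lambda>v. A *v v) ` (proj_rel `` {v})"
    then show "y \<in> proj_rel `` {A *v v}" using iff by auto
  next
    fix y assume "y \<in> proj_rel `` {A *v v}"
    then have "(A *v v, A *v (B *v y)) \<in> proj_rel" by (simp add: ABv)
    then have "B *v y \<in> proj_rel `` {v}" using iff by simp
    then show "y \<in> (\<lambda>v. A *v v) ` (proj_rel `` {v})" by (metis ABv imageI)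
  qed
qed

definition A_bar :: "'n::nontriv mod_ring list set" where
  "A_bar = {w. proj_act (word_mat w) (proj_class (vector [0, 1])) = proj_class (vector [1, 0])}"

definition periodic_word :: "nat \<Rightarrow> (int \<Rightarrow> 'a) \<Rightarrow> bool" where
  "periodic_word s W \<longleftrightarrow> (\<forall>i. W (i + int s) = W i)"

definition subwords :: "(int \<Rightarrow> 'a) \<Rightarrow> nat \<Rightarrow> 'a list set" where
  "subwords W m = {map (\<lambda>j. W (i + int j)) [0..<m] | i. True}"

end

theory Submission
  imports Defs
begin

text \<open>
  A word lies in \<open>A_bar\<close> iff the lower right entry of its matrix vanishes, which says that
  prepending any letter gives a lower triangular matrix. Hence all subwords of length \<open>n - 1\<close> lie in
  \<open>A_bar\<close> iff all subwords of length \<open>n\<close> have lower triangular matrices. The matrix of a word of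
  length \<open>l * t * s\<close> is the \<open>l\<close>-th power of that of the word of length \<open>t * s\<close>, and lower triangular
  matrices are closed under products. Some \<open>t\<close> exists because the matrix of one period has
  finite order and the matrices at different starting positions are conjugate.
\<close>

definition subword :: "(int \<Rightarrow> 'a) \<Rightarrow> int \<Rightarrow> nat \<Rightarrow> 'a list" where
  "subword W i m = map (\<lambda>j. W (i + int j)) [0..<m]"

lemma subwords_eq_range: "subwords W m = range (\<lambda>i. subword W i m)"
  by (auto simp: subwords_def subword_def)

lemma subword_0 [simp]: "subword W i 0 = []"
  by (simp add: subword_def)

lemma subword_add: "subword W i (m + n) = subword W i m @ subword W (i + int m) n"
  by (rule nth_equalityI) (auto simp: subword_def nth_append)

lemma subword_Suc: "subword W i (Suc m) = W i # subword W (i + 1) m"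
  using subword_add[of W i 1 m] by (simp add: subword_def)

lemma subword_Suc_right: "subword W i (Suc m) = subword W i m @ [W (i + int m)]"
  by (simp add: subword_def)

lemma periodic_word_mult:
  assumes "periodic_word s W"
  shows "W (i + int (k * s)) = W i"
proof (induction k)
  case (Suc k)
  have "W (i + int (Suc k * s)) = W ((i + int (k * s)) + int s)"
    by (simp add: algebra_simps)
  with Suc assms show ?case by (simp add: periodic_word_def)
qed simp

lemma subword_shift_period:
  assumes "periodic_word s W"
  shows "subword W (i + int (k * s)) m = subword W i m"
proof -
  have "W (i + int (k * s) + int j) = W (i + int j)" for j
    using periodic_word_mult[OF assms, of "i + int j" k] by (simp add: ac_simps)
  then show ?thesis by (simp add: subword_def)
qed

text \<open>The second block starts a multiple of \<open>s\<close> later, so periodicity lets it be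
  read from \<open>i\<close> again.\<close>

lemma word_mat_subword_add_period:
  assumes "periodic_word s W"
  shows "word_mat (subword W i (k * s + m)) =
    word_mat (subword W i (k * s)) ** word_mat (subword W i m)"
  unfolding subword_add word_mat_append subword_shift_period[OF assms] ..

lemma det_one_mult_left_cancel:
  fixes A :: "'a::comm_ring_1 ^ 2 ^ 2"
  assumes "det A = 1" and eq: "A ** X = A ** Y"
  shows "X = Y"
proof -
  \<comment> \<open>The adjugate of \<open>A\<close>, a left inverse because the determinant is
    1.\<close>
  define B :: "'a ^ 2 ^ 2"
    where "B = vector [vector [A $ 2 $ 2, - A $ 1 $ 2], vector [- A $ 2 $ 1, A $ 1 $ 1]]"
  have "A $ 1 $ 1 * A $ 2 $ 2 - A $ 1 $ 2 * A $ 2 $ 1 = 1"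
    using assms by (simp add: det_2)
  then have BA: "B ** A = mat 1"
    by (simp add: B_def matrix_matrix_mult_def mat_def vec_eq_iff forall_2 sum_2 algebra_simps)
  have "B ** (A ** X) = B ** (A ** Y)" using eq by simp
  then show ?thesis by (simp add: matrix_mul_assoc BA)
qed

lemma det_one_mult_right_cancel:
  fixes A :: "'a::comm_ring_1 ^ 2 ^ 2"
  assumes "det A = 1" and "X ** A = Y ** A"
  shows "X = Y"
proof -
  have "transpose A ** transpose X = transpose A ** transpose Y"
    using assms(2) by (metis matrix_transpose_mul)
  then have "transpose X = transpose Y"
    by (rule det_one_mult_left_cancel[rotated]) (simp add: assms(1))
  then show ?thesis by (metis transpose_transpose)
qed

text \<open>The image of \<open>?e2\<close> is the second column. It is a unit multiple of
  \<open>?e1\<close> only if its lower entry is 0; conversely, determinant 1 then makes its upper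
  entry a unit.\<close>

lemma A_bar_iff: "w \<in> A_bar \<longleftrightarrow> word_mat w $ 2 $ 2 = 0"
proof -
  let ?M = "word_mat w"
  let ?e2 = "vector [0, 1] :: 'a mod_ring ^ 2" and ?e1 = "vector [1, 0] :: 'a mod_ring ^ 2"
  have Me2: "?M *v ?e2 = vector [?M $ 1 $ 2, ?M $ 2 $ 2]"
    by (simp add: matrix_vector_mult_def vec_eq_iff forall_2 sum_2)
  have e1: "?e1 \<in> punctured"
    by (simp add: punctured_def vec_eq_iff forall_2)
  have det: "?M $ 1 $ 1 * ?M $ 2 $ 2 - ?M $ 1 $ 2 * ?M $ 2 $ 1 = 1"
    using det_word_mat[of w] by (simp add: det_2)
  have Mp: "?M *v ?e2 \<in> punctured"
    using det by (auto simp: Me2 punctured_def vec_eq_iff forall_2)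
  have "w \<in> A_bar \<longleftrightarrow> (?M *v ?e2, ?e1) \<in> proj_rel"
    using eq_equiv_class_iff[OF equiv_proj_rel Mp e1]
    unfolding A_bar_def mem_Collect_eq proj_act_class[OF det_word_mat] unfolding proj_class_def .
  also have "\<dots> \<longleftrightarrow> ?M $ 1 $ 2 dvd 1 \<and> ?M $ 2 $ 2 = 0"
    using Mp e1 by (auto simp: proj_rel_def Me2 vec_eq_iff forall_2)
  also have "\<dots> \<longleftrightarrow> ?M $ 2 $ 2 = 0"
  proof -
    have "?M $ 1 $ 2 dvd 1" if "?M $ 2 $ 2 = 0"
    proof
      show "1 = ?M $ 1 $ 2 * (- ?M $ 2 $ 1)" using det that by simp
    qed
    then show ?thesis by blast
  qed
  finally show ?thesis .
qed

text \<open>The first row of \<open>letter_mat a\<close> is (0, 1), so multiplying by it moves the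
  second row to the top.\<close>

lemma Cons_word_mat_entry: "word_mat (a # w) $ 1 $ 2 = word_mat w $ 2 $ 2"
  by (simp add: letter_mat_def matrix_matrix_mult_def sum_2)

lemma subwords_subset_A_bar_iff:
  assumes "n \<ge> 1"
  shows "subwords W (n - 1) \<subseteq> A_bar \<longleftrightarrow> (\<forall>i. word_mat (subword W i n) $ 1 $ 2 = 0)"
proof -
  obtain m where n: "n = Suc m" using assms by (cases n) auto
  have "(\<forall>i. word_mat (subword W i n) $ 1 $ 2 = 0) \<longleftrightarrow>
      (\<forall>i. word_mat (subword W (i + 1) m) $ 2 $ 2 = 0)"
    unfolding n subword_Suc Cons_word_mat_entry ..
  \<comment> \<open>The starting position runs over all integers, so the shift by 1 is
    harmless.\<close>
  also have "\<dots> \<longleftrightarrow> (\<forall>i. word_mat (subword W i m) $ 2 $ 2 = 0)"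
    by (metis diff_add_cancel)
  also have "\<dots> \<longleftrightarrow> subwords W (n - 1) \<subseteq> A_bar"
    unfolding n subwords_eq_range image_subset_iff A_bar_iff by simp
  finally show ?thesis ..
qed

lemma word_mat_period_eq_one_everywhere:
  assumes per: "periodic_word s W" and one: "word_mat (subword W 0 (t * s)) = mat 1"
  shows "word_mat (subword W i (t * s)) = mat 1"
proof -
  have det: "det (letter_mat a) = 1" for a :: "'a mod_ring"
    using det_word_mat[of "[a]"] by simp
  \<comment> \<open>Both sides are the subword of length \<open>t * s + 1\<close> at
    \<open>i\<close>; its last letter is \<open>W i\<close> by periodicity. Hence neighbouring
    period matrices are conjugate by \<open>letter_mat (W i)\<close>.\<close>
  have "subword W i (t * s) @ [W i] = W i # subword W (i + 1) (t * s)" for i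
    by (metis subword_Suc subword_Suc_right periodic_word_mult[OF per])
  then have conj: "word_mat (subword W i (t * s)) ** letter_mat (W i) =
      letter_mat (W i) ** word_mat (subword W (i + 1) (t * s))" for i
    by (metis word_mat_append word_mat.simps(2) word_mat_singleton)
  show ?thesis
  proof (induction i rule: int_induct[where k = 0])
    case base
    show ?case by (rule one)
  next
    case (step1 i)
    show ?case
      by (rule det_one_mult_left_cancel[OF det[of "W i"]]) (use conj[of i] step1 in simp)
  next
    case (step2 i)
    show ?case
      by (rule det_one_mult_right_cancel[OF det[of "W (i - 1)"]])
        (use conj[of "i - 1"] step2 in simp)
  qed
qed

text \<open>Pigeonhole: there are finitely many matrices, so two numbers of periods give the same
  one, and cancelling the shorter product leaves the identity.\<close>

lemma exists_word_mat_period_eq_one: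
  assumes per: "periodic_word s W"
  shows "\<exists>t\<ge>1. word_mat (subword W 0 (t * s)) = mat 1"
proof -
  define f where "f k = word_mat (subword W 0 (k * s))" for k
  have "\<not> inj f"
    using finite_imageD[of f UNIV] by auto
  then obtain i j where "i < j" "f i = f j"
    unfolding inj_def by (metis linorder_neqE_nat)
  moreover have "f j = f i ** f (j - i)"
    using word_mat_subword_add_period[OF per, of 0 i "(j - i) * s"] \<open>i < j\<close>
    by (simp add: f_def flip: add_mult_distrib)
  ultimately have "f i ** f (j - i) = f i ** mat 1" by simp
  then have "f (j - i) = mat 1"
    by (rule det_one_mult_left_cancel[rotated]) (simp add: f_def det_word_mat)
  with \<open>i < j\<close> show ?thesis
    by (intro exI[of _ "j - i"]) (simp add: f_def)
qed

text \<open>Splitting off one block of length \<open>t * s\<close> writes the matrix as a product of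
  two lower triangular ones.\<close>

lemma word_mat_multiple_lower_triangular:
  assumes per: "periodic_word s W" and "word_mat (subword W i (t * s)) $ 1 $ 2 = 0"
  shows "word_mat (subword W i (l * t * s)) $ 1 $ 2 = 0"
proof (induction l)
  case 0
  show ?case by (simp add: mat_def)
next
  case (Suc l)
  then show ?case
    using word_mat_subword_add_period[OF per, of i t "l * t * s"] assms(2)
    by (simp add: algebra_simps matrix_matrix_mult_def sum_2)
qed

theorem theorem5p5:
  fixes W :: "int \<Rightarrow> 'n::nontriv mod_ring" and s :: nat
  assumes "s \<ge> 1" and "periodic_word s W"
  shows "\<exists>t\<ge>1. subwords W (t * s - 1) \<subseteq> A_bar
           \<and> (\<forall>t'\<ge>1. subwords W (t' * s - 1) \<subseteq> A_bar \<longrightarrow> t \<le> t')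
           \<and> (\<forall>l\<ge>1. subwords W (l * t * s - 1) \<subseteq> A_bar)"
proof -
  define P where "P t \<longleftrightarrow> t \<ge> 1 \<and> subwords W (t * s - 1) \<subseteq> A_bar" for t
  have P_iff: "P t \<longleftrightarrow> t \<ge> 1 \<and> (\<forall>i. word_mat (subword W i (t * s)) $ 1 $ 2 = 0)" for t
    \<comment> \<open>For \<open>t \<ge> 1\<close>, \<open>s \<ge> 1\<close> gives
      \<open>t * s \<ge> 1\<close>, so the subtraction in \<open>t * s - 1\<close> is not
      truncated.\<close>
    using subwords_subset_A_bar_iff[of "t * s" W] assms(1) by (cases "t = 0") (auto simp: P_def)
  obtain t0 where "t0 \<ge> 1" "word_mat (subword W 0 (t0 * s)) = mat 1"
    using exists_word_mat_period_eq_one[OF assms(2)] by blast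
  then have "P t0"
    using word_mat_period_eq_one_everywhere[OF assms(2)] by (simp add: P_iff mat_def)
  then have least: "P (LEAST t. P t)" by (rule LeastI)
  have "P (l * (LEAST t. P t))" if "l \<ge> 1" for l
    using least that word_mat_multiple_lower_triangular[OF assms(2)] by (simp add: P_iff)
  with least show ?thesis
    by (intro exI[of _ "LEAST t. P t"]) (auto simp: P_def intro: Least_le)
qed

end
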